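(* For $i=1,2$ consider an open quadratic program with decision variable $x_i\in\mathbb{R}^{n_i}$ and input $(u_i,c_i)\in\mathbb{R}^{m_i}\times\mathbb{R}^{\kappa}$, $$\min_{x_i\in\mathbb{R}^{n_i}}\ \tfrac12x_i^{\mathsf T}P_ix_i+\Big(q_i+N_i\begin{bmatrix} u_i \\ c_i \end{bmatrix}\Big)^{\mathsf T}x_i\quad\text{s.t.}\quad A_ix_i+M_i\begin{bmatrix} u_i \\ c_i \end{bmatrix}=b_i,$$ with $P_i$ symmetric, KKT matrix $K_i=\begin{bmatrix} P_i & A_i^{\mathsf T} \\ A_i & 0 \end{bmatrix}$ and value function $V_i(u_i,c_i)$. Let $c_{\mathrm s}\in\mathbb{R}^{\kappa}$ be given, and consider the port interconnection $$c_1+c_2=c_{\mathrm s},\qquad\nabla_{c_1}V_1(u_1,c_1)=\nabla_{c_2}V_2(u_2,c_2)\qquad(\ast)$$ and the corresponding interconnected program, with value function $V_{12}(u)$, $u=(u_1,u_2)$. Assume that (H1) $P_i\succeq0$ and $K_i$ is nonsingular for $i=1,2$; (H2) the input $(u_i,c_i)$ affects the $i$-th program through the constraints, that is, $N_i=0$, for $i=1,2$; (H3) $H_{cc}\succ0$, where $$H=\begin{bmatrix} H_{uu} & H_{uc} \\ H_{cu} & H_{cc} \end{bmatrix}$$ is the (constant) Hessian of the quadratic function $(u,c_1)\mapsto V_1(u_1,c_1)+V_2(u_2,c_{\mathrm s}-c_1)$, partitioned according to $(u,c_1)$. Then the following statements hold. (i) $V_{12}=V_1\,\Box\,V_2$,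 and, for each $u$, the infimum defining $(V_1\,\Box\,V_2)(u)$ is attained exactly at the unique $(c_1,c_2)$ satisfying $(\ast)$. (ii) For each $u$, $(x_1,x_2,c_1,c_2)$ is optimal for the interconnected program if and only if $(c_1,c_2)$ satisfies $(\ast)$ and $x_i$ is optimal for the $i$-th program at input $(u_i,c_i)$, $i=1,2$. (iii) $V_{12}$ is quadratic, with Hessian $H_{uu}-H_{uc}H_{cc}^{-1}H_{cu}$, the Schur complement of $H_{cc}$ in $H$.
   Context: The value function $V_i(u_i,c_i)$ is the infimum of the objective of the $i$-th program over its feasible $x_i$; under (H1) it is a quadratic function of $(u_i,c_i)$ (polynomial of degree at most two), so that its gradients and the Hessian $H$ are well defined. The vectors $c_1,c_2\in\mathbb{R}^\kappa$ are called shared variables. The interconnected program, for given $u=(u_1,u_2)$, minimizes the sum of the objectives of the two programs over $(x_1,x_2,c_1,c_2)$, subject to the constraints of both programs and to $c_1+c_2=c_{\mathrm s}$; $V_{12}(u)$ is its optimal value. The partial infimal convolution over the shared variables is $$(V_1\,\Box\,V_2)(u)=\inf_{c_1+c_2=c_{\mathrm s}}\{V_1(u_1,c_1)+V_2(u_2,c_2)\}.$$ *)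

theory Defs
  imports "HOL-Analysis.Analysis"
begin

text \<open>The space R^(m+k) is rendered as \<open>real ^ ('m + 'k)\<close>: the index type is the
  disjoint sum, \<open>Inl\<close> indexing the first block and \<open>Inr\<close> the second.\<close>

definition stack :: "'a ^ 'm \<Rightarrow> 'a ^ 'k \<Rightarrow> 'a ^ ('m::finite + 'k::finite)" where
  "stack v w = (\<chi> s. case s of Inl i \<Rightarrow> v $ i | Inr j \<Rightarrow> w $ j)"

definition upper :: "'a ^ ('m::finite + 'k::finite) \<Rightarrow> 'a ^ 'm" where
  "upper z = (\<chi> i. z $ Inl i)"

definition lower :: "'a ^ ('m::finite + 'k::finite) \<Rightarrow> 'a ^ 'k" where
  "lower z = (\<chi> j. z $ Inr j)"

definition block_matrix ::
  "'a ^ 'c ^ 'r \<Rightarrow> 'a ^ 'd ^ 'r \<Rightarrow> 'a ^ 'c ^ 's \<Rightarrow> 'a ^ 'd ^ 's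
    \<Rightarrow> 'a ^ ('c::finite + 'd::finite) ^ ('r::finite + 's::finite)"
where
  "block_matrix A B C D =
     (\<chi> i. case i of Inl r \<Rightarrow> stack (A $ r) (B $ r) | Inr s \<Rightarrow> stack (C $ s) (D $ s))"

definition block11 :: "'a ^ ('c::finite + 'd::finite) ^ ('r::finite + 's::finite) \<Rightarrow> 'a ^ 'c ^ 'r" where
  "block11 H = (\<chi> i j. H $ Inl i $ Inl j)"

definition block12 :: "'a ^ ('c::finite + 'd::finite) ^ ('r::finite + 's::finite) \<Rightarrow> 'a ^ 'd ^ 'r" where
  "block12 H = (\<chi> i j. H $ Inl i $ Inr j)"

definition block21 :: "'a ^ ('c::finite + 'd::finite) ^ ('r::finite + 's::finite) \<Rightarrow> 'a ^ 'c ^ 's" where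
  "block21 H = (\<chi> i j. H $ Inr i $ Inl j)"

definition block22 :: "'a ^ ('c::finite + 'd::finite) ^ ('r::finite + 's::finite) \<Rightarrow> 'a ^ 'd ^ 's" where
  "block22 H = (\<chi> i j. H $ Inr i $ Inr j)"

text \<open>Definiteness of the quadratic form only; symmetry is not part of these two predicates.\<close>

definition pos_semidef :: "real ^ 'n ^ 'n \<Rightarrow> bool" where
  "pos_semidef A \<longleftrightarrow> (\<forall>x. 0 \<le> x \<bullet> (A *v x))"

definition pos_def :: "real ^ 'n ^ 'n \<Rightarrow> bool" where
  "pos_def A \<longleftrightarrow> (\<forall>x. x \<noteq> 0 \<longrightarrow> 0 < x \<bullet> (A *v x))"

definition gradient :: "(real ^ 'n \<Rightarrow> real) \<Rightarrow> real ^ 'n \<Rightarrow> real ^ 'n" where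
  "gradient f x = (THE g. GDERIV f x :> g)"

definition hessian :: "(real ^ 'n \<Rightarrow> real) \<Rightarrow> real ^ 'n \<Rightarrow> real ^ 'n ^ 'n" where
  "hessian f x = jacobian (gradient f) (at x)"

text \<open>For an extended-real-valued function, being quadratic includes being finite everywhere.
  The degree is at most two: the matrix may vanish.\<close>

definition quadratic :: "(real ^ 'n \<Rightarrow> ereal) \<Rightarrow> bool" where
  "quadratic f \<longleftrightarrow> (\<exists>(A :: real ^ 'n ^ 'n) b c. \<forall>x. f x = ereal (x \<bullet> (A *v x) + b \<bullet> x + c))"

text \<open>Decision variable in R^n, input (u, c) in R^m x R^k, and p equality constraints.\<close>

record ('n::finite, 'm::finite, 'k::finite, 'p::finite) open_qp =
  qP :: "real ^ 'n ^ 'n"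
  qq :: "real ^ 'n"
  qN :: "real ^ ('m + 'k) ^ 'n"
  qA :: "real ^ 'n ^ 'p"
  qM :: "real ^ ('m + 'k) ^ 'p"
  qb :: "real ^ 'p"

definition objective ::
  "('n::finite, 'm::finite, 'k::finite, 'p::finite) open_qp
    \<Rightarrow> real ^ 'm \<Rightarrow> real ^ 'k \<Rightarrow> real ^ 'n \<Rightarrow> real"
where
  "objective Q u c x = 1/2 * (x \<bullet> (qP Q *v x)) + (qq Q + qN Q *v stack u c) \<bullet> x"

definition feasible ::
  "('n::finite, 'm::finite, 'k::finite, 'p::finite) open_qp
    \<Rightarrow> real ^ 'm \<Rightarrow> real ^ 'k \<Rightarrow> real ^ 'n \<Rightarrow> bool"
where
  "feasible Q u c x \<longleftrightarrow> qA Q *v x + qM Q *v stack u c = qb Q"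

definition optimal ::
  "('n::finite, 'm::finite, 'k::finite, 'p::finite) open_qp
    \<Rightarrow> real ^ 'm \<Rightarrow> real ^ 'k \<Rightarrow> real ^ 'n \<Rightarrow> bool"
where
  "optimal Q u c x \<longleftrightarrow> is_arg_min (objective Q u c) (feasible Q u c) x"

text \<open>Value functions are extended-real-valued, so that the infimum is the true one also for
  infeasible or unbounded programs.\<close>

definition val ::
  "('n::finite, 'm::finite, 'k::finite, 'p::finite) open_qp
    \<Rightarrow> real ^ 'm \<Rightarrow> real ^ 'k \<Rightarrow> ereal"
where
  "val Q u c = (INF x \<in> {x. feasible Q u c x}. ereal (objective Q u c x))"

definition KKT_matrix ::
  "('n::finite, 'm::finite, 'k::finite, 'p::finite) open_qp \<Rightarrow> real ^ ('n + 'p) ^ ('n + 'p)"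
where
  "KKT_matrix Q = block_matrix (qP Q) (transpose (qA Q)) (qA Q) 0"

text \<open>The joint input u = (u1, u2) is a stacked vector. Decision variables are the tuples
  (x1, x2, c1, c2).\<close>

definition objective12 ::
  "('n1::finite, 'm1::finite, 'k::finite, 'p1::finite) open_qp
    \<Rightarrow> ('n2::finite, 'm2::finite, 'k, 'p2::finite) open_qp
    \<Rightarrow> real ^ ('m1 + 'm2) \<Rightarrow> (real ^ 'n1) \<times> (real ^ 'n2) \<times> (real ^ 'k) \<times> (real ^ 'k) \<Rightarrow> real"
where
  "objective12 Q1 Q2 u = (\<lambda>(x1, x2, c1, c2).
     objective Q1 (upper u) c1 x1 + objective Q2 (lower u) c2 x2)"

definition feasible12 ::
  "('n1::finite, 'm1::finite, 'k::finite, 'p1::finite) open_qp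
    \<Rightarrow> ('n2::finite, 'm2::finite, 'k, 'p2::finite) open_qp \<Rightarrow> real ^ 'k
    \<Rightarrow> real ^ ('m1 + 'm2) \<Rightarrow> (real ^ 'n1) \<times> (real ^ 'n2) \<times> (real ^ 'k) \<times> (real ^ 'k) \<Rightarrow> bool"
where
  "feasible12 Q1 Q2 cs u = (\<lambda>(x1, x2, c1, c2).
     feasible Q1 (upper u) c1 x1 \<and> feasible Q2 (lower u) c2 x2 \<and> c1 + c2 = cs)"

definition optimal12 ::
  "('n1::finite, 'm1::finite, 'k::finite, 'p1::finite) open_qp
    \<Rightarrow> ('n2::finite, 'm2::finite, 'k, 'p2::finite) open_qp \<Rightarrow> real ^ 'k
    \<Rightarrow> real ^ ('m1 + 'm2) \<Rightarrow> (real ^ 'n1) \<times> (real ^ 'n2) \<times> (real ^ 'k) \<times> (real ^ 'k) \<Rightarrow> bool"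
where
  "optimal12 Q1 Q2 cs u z \<longleftrightarrow> is_arg_min (objective12 Q1 Q2 u) (feasible12 Q1 Q2 cs u) z"

definition val12 ::
  "('n1::finite, 'm1::finite, 'k::finite, 'p1::finite) open_qp
    \<Rightarrow> ('n2::finite, 'm2::finite, 'k, 'p2::finite) open_qp \<Rightarrow> real ^ 'k
    \<Rightarrow> real ^ ('m1 + 'm2) \<Rightarrow> ereal"
where
  "val12 Q1 Q2 cs u = (INF z \<in> {z. feasible12 Q1 Q2 cs u z}. ereal (objective12 Q1 Q2 u z))"

definition inf_conv ::
  "real ^ 'k \<Rightarrow> (real ^ 'm1 \<Rightarrow> real ^ 'k \<Rightarrow> ereal) \<Rightarrow> (real ^ 'm2 \<Rightarrow> real ^ 'k \<Rightarrow> ereal)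
    \<Rightarrow> real ^ ('m1::finite + 'm2::finite) \<Rightarrow> ereal"
where
  "inf_conv cs V1 V2 u =
     (INF (c1, c2) \<in> {(c1, c2). c1 + c2 = cs}. V1 (upper u) c1 + V2 (lower u) c2)"

text \<open>Gradients are those of the real-valued functions obtained by \<open>real_of_ereal\<close>, which changes
  nothing where the value functions are finite.\<close>

definition port_interconnection ::
  "real ^ 'k \<Rightarrow> (real ^ 'm1 \<Rightarrow> real ^ 'k \<Rightarrow> ereal) \<Rightarrow> (real ^ 'm2 \<Rightarrow> real ^ 'k \<Rightarrow> ereal)
    \<Rightarrow> real ^ ('m1::finite + 'm2::finite) \<Rightarrow> real ^ 'k \<Rightarrow> real ^ 'k \<Rightarrow> bool"
where
  "port_interconnection cs V1 V2 u c1 c2 \<longleftrightarrow>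
     c1 + c2 = cs \<and>
     gradient (\<lambda>c. real_of_ereal (V1 (upper u) c)) c1 =
     gradient (\<lambda>c. real_of_ereal (V2 (lower u) c)) c2"

text \<open>The function (u, c1) \<mapsto> V1 (u1, c1) + V2 (u2, cs - c1) of the stacked vector (u, c1).\<close>

definition reduced_sum ::
  "real ^ 'k \<Rightarrow> (real ^ 'm1 \<Rightarrow> real ^ 'k \<Rightarrow> ereal) \<Rightarrow> (real ^ 'm2 \<Rightarrow> real ^ 'k \<Rightarrow> ereal)
    \<Rightarrow> real ^ (('m1::finite + 'm2::finite) + 'k::finite) \<Rightarrow> real"
where
  "reduced_sum cs V1 V2 z =
     real_of_ereal (V1 (upper (upper z)) (lower z)) +
     real_of_ereal (V2 (lower (upper z)) (cs - lower z))"

end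

theory Submission
  imports Defs
begin

text \<open>The KKT system has a unique solution, affine in the input, and its primal part is optimal because
  \<open>P\<close> is positive semidefinite; hence each value function is finite, attained and quadratic. For fixed
  \<open>u\<close> the reduced sum is then a strictly convex quadratic function of \<open>c\<^sub>1\<close>, whose stationarity
  condition is equality of the two shared gradients. Completing the square in \<open>c\<^sub>1\<close> gives the unique
  minimizer and leaves the Schur complement. All statements on optimality follow because nested minima
  are attained.\<close>

section \<open>Stacked vectors and block matrices\<close>

lemma upper_stack [simp]: "upper (stack v w) = v"
  by (simp add: upper_def stack_def vec_eq_iff)

lemma lower_stack [simp]: "lower (stack v w) = w"
  by (simp add: lower_def stack_def vec_eq_iff)

lemma stack_upper_lower [simp]: "stack (upper z) (lower z) = z"
  by (auto simp add: upper_def lower_def stack_def vec_eq_iff split: sum.split)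

lemma stack_eq_iff [simp]: "stack a b = stack c d \<longleftrightarrow> a = c \<and> b = d"
  by (metis lower_stack upper_stack)

lemma stack_add: "stack a b + stack c d = stack (a + c) (b + d)"
  by (auto simp add: stack_def vec_eq_iff split: sum.split)

lemma stack_scaleR: "r *\<^sub>R stack a b = stack (r *\<^sub>R a) (r *\<^sub>R b)"
  by (auto simp add: stack_def vec_eq_iff split: sum.split)

lemma sum_UNIV_Plus:
  fixes f :: "'m::finite + 'k::finite \<Rightarrow> 'a::comm_monoid_add"
  shows "(\<Sum>s\<in>UNIV. f s) = (\<Sum>i\<in>UNIV. f (Inl i)) + (\<Sum>j\<in>UNIV. f (Inr j))"
  by (simp add: UNIV_Plus_UNIV[symmetric] sum.Plus del: UNIV_Plus_UNIV)

lemma inner_stack: "stack a b \<bullet> stack c d = a \<bullet> c + b \<bullet> (d :: real ^ 'k)"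
  by (simp add: inner_vec_def sum_UNIV_Plus stack_def)

lemma linear_upper: "linear (upper :: real ^ ('m::finite + 'k::finite) \<Rightarrow> real ^ 'm)"
  by (rule linearI) (simp_all add: upper_def vec_eq_iff)

lemma linear_lower: "linear (lower :: real ^ ('m::finite + 'k::finite) \<Rightarrow> real ^ 'k)"
  by (rule linearI) (simp_all add: lower_def vec_eq_iff)

lemma linear_stack:
  fixes f :: "'a::real_vector \<Rightarrow> real ^ 'm" and g :: "'a \<Rightarrow> real ^ 'k"
  assumes "linear f" "linear g"
  shows "linear (\<lambda>x. stack (f x) (g x))"
  by (rule linearI)
    (simp_all add: stack_add stack_scaleR linear_add[OF assms(1)] linear_add[OF assms(2)]
      linear_cmul[OF assms(1)] linear_cmul[OF assms(2)])

lemma linear_zero_fun: "linear (\<lambda>x. 0)"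
  by (rule linearI) simp_all

lemma block_matrix_mult_stack:
  fixes A :: "real ^ 'c ^ 'r"
  shows "block_matrix A B C D *v stack x y = stack (A *v x + B *v y) (C *v x + D *v y)"
  by (auto simp add: block_matrix_def stack_def matrix_vector_mult_def vec_eq_iff sum_UNIV_Plus
      split: sum.split)

lemma block_matrix_blocks: "block_matrix (block11 H) (block12 H) (block21 H) (block22 H) = H"
  by (auto simp add: block_matrix_def block11_def block12_def block21_def block22_def stack_def
      vec_eq_iff split: sum.split)

lemma matrix_mult_stack:
  fixes H :: "real ^ ('c::finite + 'd::finite) ^ ('r::finite + 's::finite)"
  shows "H *v stack x y =
    stack (block11 H *v x + block12 H *v y) (block21 H *v x + block22 H *v y)"
  by (metis block_matrix_blocks block_matrix_mult_stack)

lemma transpose_block11: "transpose (block11 H) = block11 (transpose H)"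
  by (simp add: transpose_def block11_def vec_eq_iff)

lemma transpose_block21: "transpose (block21 H) = block12 (transpose H)"
  by (simp add: transpose_def block21_def block12_def vec_eq_iff)

lemma transpose_block22: "transpose (block22 H) = block22 (transpose H)"
  by (simp add: transpose_def block22_def vec_eq_iff)

section \<open>Transposes, definiteness and inverses\<close>

lemma inner_matrix_transpose: "x \<bullet> (A *v y) = (transpose A *v x) \<bullet> (y :: real ^ 'n)"
  by (simp add: dot_lmul_matrix transpose_matrix_vector)

lemma matrix_vector_mult_minus: "A *v (- x) = - (A *v (x :: real ^ 'n))"
  using matrix_vector_mult_diff_distrib[of A 0 x] by simp

text \<open>A kernel vector makes the quadratic form vanish, so the kernel is trivial; for a square
  matrix this suffices.\<close>

lemma pos_def_invertible:
  fixes A :: "real ^ 'n ^ 'n"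
  assumes "pos_def A"
  shows "invertible A"
proof -
  have "x = 0" if "A *v x = 0" for x
    using assms that unfolding pos_def_def by (metis inner_zero_right less_irrefl)
  then show ?thesis
    by (simp add: invertible_left_inverse matrix_left_invertible_ker)
qed

lemma matrix_inv:
  assumes "invertible A"
  shows matrix_inv_right: "A ** matrix_inv A = mat 1"
    and matrix_inv_left: "matrix_inv A ** A = mat 1"
  using assms unfolding invertible_def matrix_inv_def by (rule someI2_ex, blast)+

lemma matrix_inv_cancel:
  fixes A :: "real ^ 'n ^ 'n"
  assumes "invertible A"
  shows "A *v (matrix_inv A *v x) = x" "matrix_inv A *v (A *v x) = x"
  using assms by (simp_all add: matrix_vector_mul_assoc matrix_inv_right matrix_inv_left)

text \<open>Transposing \<open>A ** matrix_inv A = mat 1\<close> gives a left inverse of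
  \<open>A\<close>, and a left inverse agrees with any right inverse.\<close>

lemma transpose_matrix_inv_symmetric:
  fixes A :: "real ^ 'n ^ 'n"
  assumes "invertible A" "transpose A = A"
  shows "transpose (matrix_inv A) = matrix_inv A"
proof -
  have "transpose (matrix_inv A) ** A = mat 1"
    by (metis assms matrix_inv_right matrix_transpose_mul transpose_mat)
  then show ?thesis
    by (metis assms(1) matrix_inv_right matrix_mul_assoc matrix_mul_lid matrix_mul_rid)
qed

section \<open>Quadratic functions in symmetric normal form\<close>

text \<open>Symmetry and the factor 1/2 make \<open>A\<close> the Hessian and
  \<open>A *v x + b\<close> the gradient; \<open>quadratic\<close> imposes neither
  normalization.\<close>

definition quadratic_fun :: "(real ^ 'n \<Rightarrow> real) \<Rightarrow> bool" where
  "quadratic_fun f \<longleftrightarrow> (\<exists>A b c. transpose A = A \<and> (\<forall>x. f x = 1/2 * (x \<bullet> (A *v x)) + b \<bullet> x + c))"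

lemma quadratic_funI:
  assumes "transpose A = A" "\<And>x. f x = 1/2 * (x \<bullet> (A *v x)) + b \<bullet> x + c"
  shows "quadratic_fun f"
  using assms unfolding quadratic_fun_def by blast

lemma quadratic_funE:
  assumes "quadratic_fun f"
  obtains A b c where "transpose A = A" "\<And>x. f x = 1/2 * (x \<bullet> (A *v x)) + b \<bullet> x + c"
  using assms unfolding quadratic_fun_def by blast

lemma quadratic_fun_add:
  assumes "quadratic_fun f" "quadratic_fun g"
  shows "quadratic_fun (\<lambda>x. f x + g x)"
proof -
  obtain A b c where f: "transpose A = A" "\<And>x. f x = 1/2 * (x \<bullet> (A *v x)) + b \<bullet> x + c"
    using assms(1) by (rule quadratic_funE) blast
  obtain A' b' c' where g: "transpose A' = A'" "\<And>x. g x = 1/2 * (x \<bullet> (A' *v x)) + b' \<bullet> x + c'"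
    using assms(2) by (rule quadratic_funE) blast
  have "transpose (A + A') = A + A'"
    using f(1) g(1) by (simp add: transpose_def vec_eq_iff)
  moreover have "f x + g x = 1/2 * (x \<bullet> ((A + A') *v x)) + (b + b') \<bullet> x + (c + c')" for x
    by (simp add: f g matrix_vector_mult_add_rdistrib inner_add_left inner_add_right field_simps)
  ultimately show ?thesis
    by (rule quadratic_funI)
qed

text \<open>With \<open>L\<close> the matrix of \<open>l\<close>, the new quadratic part is the
  congruence \<open>transpose L ** A ** L\<close>, again symmetric. Symmetry of \<open>A\<close>
  merges the two cross terms with \<open>e\<close> into one linear term.\<close>

lemma quadratic_fun_affine:
  fixes l :: "real ^ 'm \<Rightarrow> real ^ 'n"
  assumes "quadratic_fun f" "linear l"
  shows "quadratic_fun (\<lambda>x. f (l x + e))"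
proof -
  obtain A b c where f: "transpose A = A" "\<And>x. f x = 1/2 * (x \<bullet> (A *v x)) + b \<bullet> x + c"
    using assms(1) by (rule quadratic_funE) blast
  define L where "L = matrix l"
  have l: "l x = L *v x" for x
    by (simp add: L_def matrix_works assms(2))
  let ?B = "transpose L ** A ** L"
  have "transpose ?B = ?B"
    by (simp add: matrix_transpose_mul f(1) matrix_mul_assoc)
  moreover have "f (l x + e) = 1/2 * (x \<bullet> (?B *v x)) + (transpose L *v (A *v e + b)) \<bullet> x
      + (1/2 * (e \<bullet> (A *v e)) + b \<bullet> e + c)" for x
  proof -
    have "x \<bullet> (?B *v x) = (L *v x) \<bullet> (A *v (L *v x))"
      by (simp add: matrix_vector_mul_assoc[symmetric] inner_matrix_transpose[of x]
          del: transpose_matrix_vector)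
    moreover have "(transpose L *v (A *v e + b)) \<bullet> x = (L *v x) \<bullet> (A *v e) + b \<bullet> (L *v x)"
      by (metis inner_matrix_transpose inner_add_left inner_commute)
    moreover have "e \<bullet> (A *v (L *v x)) = (L *v x) \<bullet> (A *v e)"
      by (metis f(1) inner_matrix_transpose inner_commute)
    ultimately show ?thesis
      by (simp add: f(2) l matrix_vector_right_distrib inner_add_left inner_add_right field_simps)
  qed
  ultimately show ?thesis
    by (rule quadratic_funI)
qed

section \<open>Gradients and Hessians of quadratic functions\<close>

text \<open>Discharges the definite description in \<open>gradient\<close>: derivatives are unique,
  and a vector is determined by its inner products.\<close>

lemma gradient_eqI:
  assumes "GDERIV f x :> g"
  shows "gradient f x = g"
  unfolding gradient_def
proof (rule the_equality)
  show "GDERIV f x :> g" by fact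
  fix g' assume "GDERIV f x :> g'"
  then have "(\<lambda>h. h \<bullet> g') = (\<lambda>h. h \<bullet> g)"
    using assms unfolding gderiv_def by (rule has_derivative_unique)
  then show "g' = g"
    by (metis vector_eq_ldot)
qed

text \<open>The product rule yields \<open>x \<bullet> (A *v h)\<close> and
  \<open>h \<bullet> (A *v x)\<close>; symmetry of \<open>A\<close> makes them equal, which absorbs
  the factor 1/2.\<close>

lemma GDERIV_quadratic:
  fixes A :: "real ^ 'n ^ 'n"
  assumes "transpose A = A" "\<And>x. f x = 1/2 * (x \<bullet> (A *v x)) + b \<bullet> x + c"
  shows "GDERIV f x :> A *v x + b"
proof -
  have A: "((\<lambda>x. A *v x) has_derivative (\<lambda>h. A *v h)) (at x)"
    using matrix_vector_mul_bounded_linear by (rule bounded_linear_imp_has_derivative)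
  have eq: "x \<bullet> (A *v h) = h \<bullet> (A *v x)" for h
    by (metis assms(1) inner_matrix_transpose inner_commute)
  have "((\<lambda>x. 1/2 * (x \<bullet> (A *v x)) + b \<bullet> x + c) has_derivative (\<lambda>h. h \<bullet> (A *v x + b))) (at x)"
    by (rule derivative_eq_intros A refl)+
      (simp add: fun_eq_iff eq inner_add_right inner_commute[of b])
  then show ?thesis
    unfolding gderiv_def by (simp add: assms(2)[abs_def])
qed

text \<open>The gradient is affine with linear part \<open>A\<close>, so its Jacobian is
  \<open>A\<close> at every point.\<close>

lemma hessian_quadratic:
  fixes A :: "real ^ 'n ^ 'n"
  assumes "transpose A = A" "\<And>x. f x = 1/2 * (x \<bullet> (A *v x)) + b \<bullet> x + c"
  shows "hessian f x = A"
proof -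
  have grad: "gradient f = (\<lambda>x. A *v x + b)"
    using gradient_eqI[OF GDERIV_quadratic[OF assms]] by blast
  have "((\<lambda>x. A *v x) has_derivative (\<lambda>h. A *v h)) (at x)"
    using matrix_vector_mul_bounded_linear by (rule bounded_linear_imp_has_derivative)
  then have "((\<lambda>x. A *v x + b) has_derivative (\<lambda>h. A *v h)) (at x)"
    by (rule has_derivative_add_const)
  then have "frechet_derivative (gradient f) (at x) = (\<lambda>h. A *v h)"
    unfolding grad by (metis frechet_derivative_at)
  then show ?thesis
    by (simp add: hessian_def jacobian_def)
qed

lemma GDERIV_quadratic_fun:
  assumes "quadratic_fun f"
  shows "GDERIV f x :> gradient f x"
  using assms by (metis GDERIV_quadratic gradient_eqI quadratic_funE)

lemma quadratic_ereal:
  assumes "quadratic_fun f"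
  shows "quadratic (\<lambda>x. ereal (f x))"
proof -
  obtain A b c where f: "\<And>x. f x = 1/2 * (x \<bullet> (A *v x)) + b \<bullet> x + c"
    using assms by (rule quadratic_funE) blast
  have "f x = x \<bullet> (((1/2) *\<^sub>R A) *v x) + b \<bullet> x + c" for x
    by (simp add: f scaleR_matrix_vector_assoc[symmetric])
  then show ?thesis
    unfolding quadratic_def by (intro exI[of _ "(1/2) *\<^sub>R A"] exI[of _ b] exI[of _ c]) simp
qed

section \<open>Completing the square and attained minima\<close>

text \<open>The second hypothesis makes \<open>y\<close> a stationary point. Substituting
  \<open>w = - (A *v y)\<close> turns the linear term into the cross term of the square centred at
  \<open>y\<close>.\<close>

lemma complete_square:
  fixes A :: "real ^ 'n ^ 'n"
  assumes "transpose A = A" "A *v y + w = 0"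
  shows "1/2 * (x \<bullet> (A *v x)) + w \<bullet> x =
    1/2 * ((x - y) \<bullet> (A *v (x - y))) - 1/2 * (y \<bullet> (A *v y))"
proof -
  have "w = - (A *v y)"
    using assms(2) by (simp add: eq_neg_iff_add_eq_0 add.commute)
  moreover have "y \<bullet> (A *v x) = x \<bullet> (A *v y)"
    by (metis assms(1) inner_matrix_transpose inner_commute)
  ultimately show ?thesis
    by (simp add: matrix_vector_mult_diff_distrib inner_diff_left inner_diff_right
        inner_commute[of "A *v y"] field_simps)
qed

text \<open>This lemma and the next reduce \<open>INF\<close> and \<open>is_arg_min\<close> to one
  pattern: a lower bound together with a point that attains it.\<close>

lemma INF_eq_attained:
  fixes f :: "'a \<Rightarrow> 'b::complete_lattice"
  assumes "\<And>x. x \<in> S \<Longrightarrow> m \<le> f x" "\<exists>y\<in>S. f y = m"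
  shows "(INF x\<in>S. f x) = m"
  using assms by (metis INF_greatest INF_lower antisym)

lemma is_arg_min_iff_attained:
  fixes f :: "'a \<Rightarrow> 'b::linorder"
  assumes "\<And>x. P x \<Longrightarrow> m \<le> f x" "\<exists>y. P y \<and> f y = m"
  shows "is_arg_min f P x \<longleftrightarrow> P x \<and> f x = m"
  using assms unfolding is_arg_min_def by (metis less_le not_less)

section \<open>KKT points and the value function of one program\<close>

text \<open>Expanding the objective around \<open>x\<close> with \<open>d = y - x\<close> leaves
  half the form of \<open>qP Q\<close> at \<open>d\<close> plus the gradient at \<open>x\<close>
  times \<open>d\<close>. The gradient lies in the range of \<open>transpose (qA Q)\<close> and
  \<open>d\<close> in the kernel of \<open>qA Q\<close>, so the linear term vanishes.\<close>

lemma KKT_point_minimizes: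
  assumes "transpose (qP Q) = qP Q" "pos_semidef (qP Q)" "qN Q = 0"
    and "qP Q *v x + transpose (qA Q) *v l = - qq Q"
    and "feasible Q u c x" "feasible Q u c y"
  shows "objective Q u c x \<le> objective Q u c y"
proof -
  let ?d = "y - x"
  have "qA Q *v x = qA Q *v y"
    using assms(5,6) unfolding feasible_def by (metis add_right_imp_eq)
  then have Ad: "qA Q *v ?d = 0"
    by (simp add: matrix_vector_mult_diff_distrib)
  have "(qP Q *v x + qq Q) \<bullet> ?d = - ((transpose (qA Q) *v l) \<bullet> ?d)"
  proof -
    have "qP Q *v x + qq Q = - (transpose (qA Q) *v l)"
      using assms(4) by (simp add: eq_neg_iff_add_eq_0 add_ac)
    then show ?thesis by simp
  qed
  also have "\<dots> = 0"
    by (metis Ad inner_matrix_transpose inner_zero_right neg_0_equal_iff_equal)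
  finally have 1: "(qP Q *v x + qq Q) \<bullet> ?d = 0" .
  have 2: "0 \<le> ?d \<bullet> (qP Q *v ?d)"
    using assms(2) unfolding pos_semidef_def by blast
  have 3: "x \<bullet> (qP Q *v y) = y \<bullet> (qP Q *v x)"
    by (metis assms(1) inner_matrix_transpose inner_commute)
  have "objective Q u c y - objective Q u c x = 1/2 * (?d \<bullet> (qP Q *v ?d)) + (qP Q *v x + qq Q) \<bullet> ?d"
    using 3 by (simp add: objective_def assms(3) matrix_vector_mult_diff_distrib inner_diff_left
        inner_diff_right inner_add_left inner_commute[of "qP Q *v x"] field_simps)
  then show ?thesis
    using 1 2 by simp
qed

text \<open>Nonsingularity makes the KKT system solvable for every input, with primal part affine in
  the input; \<open>v\<close> is the objective along this affine family of minimizers.\<close>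

lemma value_function_quadratic:
  fixes Q :: "('n::finite, 'm::finite, 'k::finite, 'p::finite) open_qp"
  assumes "transpose (qP Q) = qP Q" "pos_semidef (qP Q)" "invertible (KKT_matrix Q)" "qN Q = 0"
  obtains v where "quadratic_fun v"
    and "\<And>u c x. feasible Q u c x \<Longrightarrow> v (stack u c) \<le> objective Q u c x"
    and "\<And>u c. \<exists>x. feasible Q u c x \<and> objective Q u c x = v (stack u c)"
proof -
  \<comment> \<open>The KKT right-hand side is split into its part linear in the input
    \<open>z\<close>, giving \<open>l\<close>, and its constant part, giving
    \<open>e\<close>.\<close>
  define l where "l z = upper (matrix_inv (KKT_matrix Q) *v stack 0 (- (qM Q *v z)))" for z
  define e where "e = upper (matrix_inv (KKT_matrix Q) *v stack (- qq Q) (qb Q))"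
  \<comment> \<open>The input does not enter the linear cost, because \<open>qN Q = 0\<close>. The
    \<open>+ 0\<close> is the constant term of the normal form.\<close>
  define v where "v z = 1/2 * ((l z + e) \<bullet> (qP Q *v (l z + e))) + qq Q \<bullet> (l z + e) + 0" for z
  have "linear (\<lambda>z. stack 0 (- (qM Q *v z)) :: real ^ ('n + 'p))"
    by (intro linear_stack linear_zero_fun linear_compose_neg matrix_vector_mul_linear)
  then have "linear l"
    unfolding l_def
    by (rule linear_compose[OF linear_compose[OF _ matrix_vector_mul_linear] linear_upper, unfolded o_def])
  moreover have "quadratic_fun (\<lambda>x. 1/2 * (x \<bullet> (qP Q *v x)) + qq Q \<bullet> x + 0)"
    using assms(1) by (rule quadratic_funI) (rule refl)
  ultimately have "quadratic_fun v"
    unfolding v_def[abs_def] by (rule quadratic_fun_affine[rotated])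
  moreover have "\<exists>x. feasible Q u c x \<and> objective Q u c x = v (stack u c) \<and>
      (\<forall>y. feasible Q u c y \<longrightarrow> objective Q u c x \<le> objective Q u c y)" for u c
  proof -
    let ?r = "stack (- qq Q) (qb Q - qM Q *v stack u c) :: real ^ ('n + 'p)"
    define s where "s = matrix_inv (KKT_matrix Q) *v ?r"
    have r: "?r = stack 0 (- (qM Q *v stack u c)) + stack (- qq Q) (qb Q)"
      by (simp add: stack_add)
    have x: "upper s = l (stack u c) + e"
      unfolding s_def l_def e_def r
      by (simp add: matrix_vector_right_distrib linear_add[OF linear_upper])
    have "KKT_matrix Q *v stack (upper s) (lower s) = ?r"
      unfolding stack_upper_lower by (simp add: s_def matrix_inv_cancel[OF assms(3)])
    then have s: "qP Q *v upper s + transpose (qA Q) *v lower s = - qq Q"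
        "qA Q *v upper s = qb Q - qM Q *v stack u c"
      unfolding KKT_matrix_def block_matrix_mult_stack stack_eq_iff by simp_all
    have "feasible Q u c (upper s)"
      by (simp add: feasible_def s(2))
    moreover have "objective Q u c (upper s) = v (stack u c)"
      by (simp add: objective_def assms(4) v_def x)
    ultimately show ?thesis
      using KKT_point_minimizes[OF assms(1,2,4) s(1)] by blast
  qed
  ultimately show ?thesis
    using that by metis
qed

theorem theorem6:
  fixes Q1 :: "('n1::finite, 'm1::finite, 'k::finite, 'p1::finite) open_qp"
    and Q2 :: "('n2::finite, 'm2::finite, 'k, 'p2::finite) open_qp"
    and cs :: "real ^ 'k"
    and V1 :: "real ^ 'm1 \<Rightarrow> real ^ 'k \<Rightarrow> ereal"
    and V2 :: "real ^ 'm2 \<Rightarrow> real ^ 'k \<Rightarrow> ereal"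
    and V12 :: "real ^ ('m1 + 'm2) \<Rightarrow> ereal"
    and z0 :: "real ^ (('m1 + 'm2) + 'k)"
    and H :: "real ^ (('m1 + 'm2) + 'k) ^ (('m1 + 'm2) + 'k)"
  assumes V_def: "V1 = val Q1" "V2 = val Q2" "V12 = val12 Q1 Q2 cs"
    and P_sym: "transpose (qP Q1) = qP Q1" "transpose (qP Q2) = qP Q2"
    and H1_psd: "pos_semidef (qP Q1)" "pos_semidef (qP Q2)"
    and H1_KKT: "invertible (KKT_matrix Q1)" "invertible (KKT_matrix Q2)"
    and H2: "qN Q1 = 0" "qN Q2 = 0"
    \<comment> \<open>The base point \<open>z0\<close> is arbitrary, so constancy of the Hessian is not assumed.\<close>
    and H_def: "H = hessian (reduced_sum cs V1 V2) z0"
    and H3: "pos_def (block22 H)"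
  shows "(V12 = inf_conv cs V1 V2 \<and>
          (\<forall>u. (\<exists>!(c1, c2). port_interconnection cs V1 V2 u c1 c2) \<and>
             (\<forall>c1 c2. (c1 + c2 = cs \<and> V1 (upper u) c1 + V2 (lower u) c2 = inf_conv cs V1 V2 u)
                       \<longleftrightarrow> port_interconnection cs V1 V2 u c1 c2))) \<and>
         (\<forall>u x1 x2 c1 c2. optimal12 Q1 Q2 cs u (x1, x2, c1, c2) \<longleftrightarrow>
             port_interconnection cs V1 V2 u c1 c2 \<and>
             optimal Q1 (upper u) c1 x1 \<and> optimal Q2 (lower u) c2 x2) \<and>
         (quadratic V12 \<and>
          (\<forall>u. hessian (\<lambda>u. real_of_ereal (V12 u)) u =
             block11 H - block12 H ** matrix_inv (block22 H) ** block21 H))"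
proof -

  \<comment> \<open>Value functions of the two programs\<close>
  obtain v1 where v1: "quadratic_fun v1"
      "\<And>u c x. feasible Q1 u c x \<Longrightarrow> v1 (stack u c) \<le> objective Q1 u c x"
      "\<And>u c. \<exists>x. feasible Q1 u c x \<and> objective Q1 u c x = v1 (stack u c)"
    using value_function_quadratic[OF P_sym(1) H1_psd(1) H1_KKT(1) H2(1)] by metis
  obtain v2 where v2: "quadratic_fun v2"
      "\<And>u c x. feasible Q2 u c x \<Longrightarrow> v2 (stack u c) \<le> objective Q2 u c x"
      "\<And>u c. \<exists>x. feasible Q2 u c x \<and> objective Q2 u c x = v2 (stack u c)"
    using value_function_quadratic[OF P_sym(2) H1_psd(2) H1_KKT(2) H2(2)] by metis
  have V1: "V1 u c = ereal (v1 (stack u c))" for u c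
    unfolding V_def val_def by (rule INF_eq_attained) (use v1(2,3) in auto)
  have V2: "V2 u c = ereal (v2 (stack u c))" for u c
    unfolding V_def val_def by (rule INF_eq_attained) (use v2(2,3) in auto)
  have opt1: "optimal Q1 u c x \<longleftrightarrow> feasible Q1 u c x \<and> objective Q1 u c x = v1 (stack u c)" for u c x
    unfolding optimal_def using v1(2,3) by (rule is_arg_min_iff_attained)
  have opt2: "optimal Q2 u c x \<longleftrightarrow> feasible Q2 u c x \<and> objective Q2 u c x = v2 (stack u c)" for u c x
    unfolding optimal_def using v2(2,3) by (rule is_arg_min_iff_attained)

  \<comment> \<open>The reduced sum and its Hessian\<close>
  define R where "R = reduced_sum cs V1 V2"
  have R_stack: "R (stack u c) = v1 (stack (upper u) c) + v2 (stack (lower u) (cs - c))" for u c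
    by (simp add: R_def reduced_sum_def V1 V2)
  have "quadratic_fun R"
  proof -
    have lu: "linear (\<lambda>z :: real ^ (('m1 + 'm2) + 'k). lower (upper z) :: real ^ 'm2)"
      using linear_compose[OF linear_upper linear_lower] by (simp add: o_def)
    \<comment> \<open>Both arguments are affine in \<open>z\<close>: the shift is 0 for the first
      program and \<open>stack 0 cs\<close> for the second, whose shared variable is
      \<open>cs - lower z\<close>.\<close>
    have "quadratic_fun (\<lambda>z :: real ^ (('m1 + 'm2) + 'k). v1 (stack (upper (upper z)) (lower z) + 0))"
      using linear_compose[OF linear_upper linear_upper]
      by (intro quadratic_fun_affine v1(1) linear_stack linear_lower) (simp add: o_def)
    moreover have "quadratic_fun (\<lambda>z :: real ^ (('m1 + 'm2) + 'k).
        v2 (stack (lower (upper z)) (- lower z) + stack 0 cs))"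
      by (intro quadratic_fun_affine v2(1) linear_stack lu linear_compose_neg linear_lower)
    ultimately have "quadratic_fun (\<lambda>z :: real ^ (('m1 + 'm2) + 'k).
        v1 (stack (upper (upper z)) (lower z) + 0) + v2 (stack (lower (upper z)) (- lower z) + stack 0 cs))"
      by (rule quadratic_fun_add)
    then show ?thesis
      by (simp add: R_def reduced_sum_def[abs_def] V1 V2 stack_add)
  qed
  then obtain A b d where A: "transpose A = A" "\<And>z. R z = 1/2 * (z \<bullet> (A *v z)) + b \<bullet> z + d"
    by (rule quadratic_funE) blast
  \<comment> \<open>The Hessian of a quadratic function is the same everywhere, so the choice of
    \<open>z0\<close> drops out.\<close>
  have "H = A"
    unfolding H_def using hessian_quadratic[OF A] by (simp add: R_def)
  with A have H_sym: "transpose H = H" and R: "\<And>z. R z = 1/2 * (z \<bullet> (H *v z)) + b \<bullet> z + d"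
    by simp_all
  let ?Huu = "block11 H" and ?Huc = "block12 H" and ?Hcu = "block21 H" and ?Hcc = "block22 H"
  let ?J = "matrix_inv ?Hcc"
  have sym: "transpose ?Huu = ?Huu" "transpose ?Hcu = ?Huc" "transpose ?Huc = ?Hcu"
      "transpose ?Hcc = ?Hcc"
    using transpose_block11[of H] transpose_block21[of H] transpose_block22[of H] H_sym
    by (simp_all, metis transpose_transpose)
  have inv: "invertible ?Hcc"
    using H3 by (rule pos_def_invertible)
  have J_sym: "transpose ?J = ?J"
    using inv sym(4) by (rule transpose_matrix_inv_symmetric)

  \<comment> \<open>Completing the square in the shared variable\<close>
  define w where "w u = ?Hcu *v u + lower b" for u
  \<comment> \<open>With \<open>w u\<close> the coefficient of the linear term in \<open>c\<close>,
    the stationary point is \<open>c0 u\<close>, and \<open>m u\<close> is the value of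
    \<open>R (stack u c)\<close> there.\<close>
  define m where "m u = 1/2 * (u \<bullet> (?Huu *v u)) + upper b \<bullet> u + d - 1/2 * (w u \<bullet> (?J *v w u))" for u
  define c0 where "c0 u = - (?J *v w u)" for u
  have Hcc_c0: "?Hcc *v c0 u + w u = 0" for u
    by (simp add: c0_def matrix_vector_mult_minus matrix_inv_cancel[OF inv])
  have R_split: "R (stack u c) =
      1/2 * (u \<bullet> (?Huu *v u)) + upper b \<bullet> u + d + (1/2 * (c \<bullet> (?Hcc *v c)) + w u \<bullet> c)" for u c
  proof -
    have "b \<bullet> stack u c = upper b \<bullet> u + lower b \<bullet> c"
      by (metis inner_stack stack_upper_lower)
    moreover have "u \<bullet> (?Huc *v c) = c \<bullet> (?Hcu *v u)"
      by (metis inner_matrix_transpose inner_commute sym(3))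
    ultimately show ?thesis
      unfolding R matrix_mult_stack inner_stack w_def
      by (simp add: inner_add_left inner_add_right inner_commute[of _ c] field_simps)
  qed
  have R_square: "R (stack u c) = m u + 1/2 * ((c - c0 u) \<bullet> (?Hcc *v (c - c0 u)))" for u c
  proof -
    have "c0 u \<bullet> (?Hcc *v c0 u) = w u \<bullet> (?J *v w u)"
      by (simp add: c0_def matrix_vector_mult_minus matrix_inv_cancel[OF inv] inner_commute)
    then show ?thesis
      unfolding R_split complete_square[OF sym(4) Hcc_c0] m_def by simp
  qed
  have Hcc_nonneg: "0 \<le> x \<bullet> (?Hcc *v x)" and Hcc_zero: "x \<bullet> (?Hcc *v x) = 0 \<longleftrightarrow> x = 0" for x
    using H3 unfolding pos_def_def by (cases "x = 0"; force)+
  \<comment> \<open>Semidefiniteness gives the bound \<open>m u\<close> and definiteness its unique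
    minimizer \<open>c0 u\<close>; all minimality and uniqueness claims over \<open>c\<close> rest
    on these two facts.\<close>
  have R_ge: "m u \<le> R (stack u c)" for u c
    by (simp add: R_square Hcc_nonneg)
  have R_eq: "R (stack u c) = m u \<longleftrightarrow> c = c0 u" for u c
    by (simp add: R_square Hcc_zero)
  have sum_eq: "v1 (stack (upper u) c1) + v2 (stack (lower u) c2) = R (stack u c1)"
    if "c1 + c2 = cs" for u c1 c2
    using that by (auto simp: R_stack)

  \<comment> \<open>Infimal convolution and port condition\<close>
  have conv: "inf_conv cs V1 V2 u = ereal (m u)" for u
    unfolding inf_conv_def
  proof (rule INF_eq_attained)
    show "\<exists>z\<in>{(c1, c2). c1 + c2 = cs}. (case z of (c1, c2) \<Rightarrow> V1 (upper u) c1 + V2 (lower u) c2) = ereal (m u)"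
      by (rule bexI[of _ "(c0 u, cs - c0 u)"]) (simp_all add: V1 V2 sum_eq R_eq)
  qed (auto simp: V1 V2 sum_eq R_ge)

  have port: "port_interconnection cs V1 V2 u c1 c2 \<longleftrightarrow> c1 = c0 u \<and> c2 = cs - c0 u" for u c1 c2
  proof -
    let ?g1 = "\<lambda>c. v1 (stack (upper u) c)" and ?g2 = "\<lambda>c. v2 (stack (lower u) c)"
    \<comment> \<open>The derivative of \<open>R (stack u c)\<close> in \<open>c\<close> is computed
      twice: by the chain rule, where \<open>cs - c\<close> flips the sign of the second gradient,
      and from the explicit quadratic form.\<close>
    have stationary: "gradient ?g1 c - gradient ?g2 (cs - c) = ?Hcc *v (c - c0 u)" for c
    proof -
      \<comment> \<open>Freezing \<open>u\<close> is an affine substitution, so each slice is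
        quadratic and its gradient is a true derivative.\<close>
      have "quadratic_fun (\<lambda>c. v1 (stack 0 c + stack (upper u) 0))"
        by (intro quadratic_fun_affine v1(1) linear_stack linear_zero_fun linear_ident)
      then have "quadratic_fun ?g1"
        by (simp add: stack_add)
      then have g1: "(?g1 has_derivative (\<lambda>h. h \<bullet> gradient ?g1 c)) (at c)"
        using GDERIV_quadratic_fun unfolding gderiv_def by blast
      have "quadratic_fun (\<lambda>c. v2 (stack 0 c + stack (lower u) 0))"
        by (intro quadratic_fun_affine v2(1) linear_stack linear_zero_fun linear_ident)
      then have "quadratic_fun ?g2"
        by (simp add: stack_add)
      then have g2: "(?g2 has_derivative (\<lambda>h. h \<bullet> gradient ?g2 (cs - c))) (at (cs - c))"
        using GDERIV_quadratic_fun unfolding gderiv_def by blast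
      have "((\<lambda>c. cs - c) has_derivative (\<lambda>h. - h)) (at c)"
        by (rule derivative_eq_intros refl)+ simp
      from has_derivative_add[OF g1 has_derivative_compose[OF this g2]]
      have "GDERIV (\<lambda>c. R (stack u c)) c :> gradient ?g1 c - gradient ?g2 (cs - c)"
        by (simp add: gderiv_def R_stack inner_diff_right)
      moreover have "GDERIV (\<lambda>c. R (stack u c)) c :> ?Hcc *v c + w u"
        by (rule GDERIV_quadratic[OF sym(4), where c = "1/2 * (u \<bullet> (?Huu *v u)) + upper b \<bullet> u + d"])
          (simp add: R_split)
      ultimately have "gradient ?g1 c - gradient ?g2 (cs - c) = ?Hcc *v c + w u"
        by (metis gradient_eqI)
      also have "\<dots> = ?Hcc *v (c - c0 u)"
        using Hcc_c0[of u] by (simp add: matrix_vector_mult_diff_distrib eq_neg_iff_add_eq_0[symmetric])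
      finally show ?thesis .
    qed
    have "gradient ?g1 c = gradient ?g2 (cs - c) \<longleftrightarrow> c = c0 u" for c
      using stationary[of c] matrix_inv_cancel(2)[OF inv, of "c - c0 u"]
      by (metis matrix_vector_mult_0_right right_minus_eq)
    then show ?thesis
      unfolding port_interconnection_def V1 V2 real_of_ereal.simps
      by (metis add_diff_cancel_left' diff_add_cancel add.commute)
  qed
  \<comment> \<open>Trades the gradient condition for attainment of \<open>m u\<close>, the form in
    which it enters (i) and (ii).\<close>
  have port_iff: "port_interconnection cs V1 V2 u c1 c2 \<longleftrightarrow>
      c1 + c2 = cs \<and> v1 (stack (upper u) c1) + v2 (stack (lower u) c2) = m u" for u c1 c2
  proof (cases "c1 + c2 = cs")
    case True
    then have "c2 = cs - c1" by auto
    with True show ?thesis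
      by (simp add: port sum_eq R_eq)
  qed (auto simp: port)

  \<comment> \<open>The interconnected program\<close>
  have ge12: "m u \<le> objective12 Q1 Q2 u z" if "feasible12 Q1 Q2 cs u z" for u z
  proof -
    obtain x1 x2 c1 c2 where z: "z = (x1, x2, c1, c2)"
      by (metis prod_cases4)
    with that show ?thesis
      using v1(2)[of "upper u" c1 x1] v2(2)[of "lower u" c2 x2] R_ge[of u c1] sum_eq[of c1 c2 u]
      unfolding feasible12_def objective12_def by simp
  qed
  have attained12: "\<exists>z. feasible12 Q1 Q2 cs u z \<and> objective12 Q1 Q2 u z = m u" for u
  proof -
    \<comment> \<open>The witness nests the minimizers: shared variables at \<open>c0 u\<close> and
      \<open>cs - c0 u\<close>, then an optimal \<open>x1\<close> and \<open>x2\<close> for these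
      inputs.\<close>
    obtain x1 where x1: "feasible Q1 (upper u) (c0 u) x1"
        "objective Q1 (upper u) (c0 u) x1 = v1 (stack (upper u) (c0 u))"
      using v1(3) by blast
    obtain x2 where x2: "feasible Q2 (lower u) (cs - c0 u) x2"
        "objective Q2 (lower u) (cs - c0 u) x2 = v2 (stack (lower u) (cs - c0 u))"
      using v2(3) by blast
    show ?thesis
      using x1 x2 sum_eq[of "c0 u" "cs - c0 u" u] R_eq[of u "c0 u"]
      by (intro exI[of _ "(x1, x2, c0 u, cs - c0 u)"]) (simp add: feasible12_def objective12_def)
  qed
  have V12: "V12 u = ereal (m u)" for u
    unfolding V_def val12_def by (rule INF_eq_attained) (use ge12 attained12 in auto)
  have opt12: "optimal12 Q1 Q2 cs u z \<longleftrightarrow> feasible12 Q1 Q2 cs u z \<and> objective12 Q1 Q2 u z = m u" for u z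
    unfolding optimal12_def using ge12 attained12 by (rule is_arg_min_iff_attained)

  have part_ii: "optimal12 Q1 Q2 cs u (x1, x2, c1, c2) \<longleftrightarrow>
      port_interconnection cs V1 V2 u c1 c2 \<and>
      optimal Q1 (upper u) c1 x1 \<and> optimal Q2 (lower u) c2 x2" for u x1 x2 c1 c2
  proof -
    \<comment> \<open>The bounds chain from \<open>m u\<close> through the sum of the two values to
      the sum of the two objectives. The ends agree exactly when every inequality is tight: the port
      condition and optimality of each program.\<close>
    have "m u \<le> v1 (stack (upper u) c1) + v2 (stack (lower u) c2)" if "c1 + c2 = cs"
      using R_ge sum_eq[OF that] by simp
    then show ?thesis
      using v1(2)[of "upper u" c1 x1] v2(2)[of "lower u" c2 x2]
      unfolding opt12 opt1 opt2 port_iff feasible12_def objective12_def by fastforce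
  qed

  \<comment> \<open>The Schur complement\<close>
  let ?S = "?Huu - ?Huc ** ?J ** ?Hcu"
  have S_sym: "transpose ?S = ?S"
  proof -
    have "transpose (?Huc ** ?J ** ?Hcu) = ?Huc ** ?J ** ?Hcu"
      by (simp add: matrix_transpose_mul sym J_sym matrix_mul_assoc)
    then show ?thesis
      using sym(1) by (simp add: transpose_def vec_eq_iff)
  qed
  \<comment> \<open>Expanding the form of \<open>?J\<close> at \<open>w u\<close>, a sum of
    \<open>?Hcu *v u\<close> and \<open>lower b\<close>, gives the Schur correction, two equal cross
    terms for the linear part, and a constant.\<close>
  have m: "m u = 1/2 * (u \<bullet> (?S *v u)) + (upper b - ?Huc *v (?J *v lower b)) \<bullet> u
      + (d - 1/2 * (lower b \<bullet> (?J *v lower b)))" for u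
  proof -
    have "u \<bullet> ((?Huc ** ?J ** ?Hcu) *v u) = (?Hcu *v u) \<bullet> (?J *v (?Hcu *v u))"
      by (simp add: matrix_vector_mul_assoc[symmetric] inner_matrix_transpose[of u ?Huc] sym)
    moreover have "(?Huc *v (?J *v lower b)) \<bullet> u = (?Hcu *v u) \<bullet> (?J *v lower b)"
      by (metis inner_matrix_transpose inner_commute sym(3))
    moreover have "lower b \<bullet> (?J *v (?Hcu *v u)) = (?Hcu *v u) \<bullet> (?J *v lower b)"
      by (metis inner_matrix_transpose inner_commute J_sym)
    ultimately show ?thesis
      unfolding m_def w_def
      by (simp add: matrix_vector_right_distrib matrix_vector_mult_diff_rdistrib inner_add_left
          inner_add_right inner_diff_left inner_diff_right field_simps)
  qed
  have "quadratic V12"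
    using quadratic_ereal[OF quadratic_funI[OF S_sym m]] by (simp add: V12[abs_def])
  moreover have "hessian (\<lambda>u. real_of_ereal (V12 u)) u = ?S" for u
    using hessian_quadratic[OF S_sym m] by (simp add: V12)
  moreover have "V12 = inf_conv cs V1 V2"
    by (rule ext) (simp add: V12 conv)
  moreover have "\<exists>!(c1, c2). port_interconnection cs V1 V2 u c1 c2" for u
    unfolding port by auto
  moreover have "c1 + c2 = cs \<and> V1 (upper u) c1 + V2 (lower u) c2 = inf_conv cs V1 V2 u
      \<longleftrightarrow> port_interconnection cs V1 V2 u c1 c2" for u c1 c2
    unfolding port_iff conv V1 V2 by simp
  ultimately show ?thesis
    using part_ii by blast
qed

end
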